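(* Let $\lambda\in\mathbb{C}^*$, let $a_1,a_2\in\mathbb{C}$ with $a_1+a_2\notin\mathbb{Q}_{\le0}$, let $c_1,c_2\in v\,\mathbb{C}[[v]]$, and consider $$Z=x^2\frac{\partial}{\partial x}+\big(-\lambda+a_1x+c_1(y_1y_2)\big)y_1\frac{\partial}{\partial y_1}+\big(\lambda+a_2x+c_2(y_1y_2)\big)y_2\frac{\partial}{\partial y_2}.$$ Then $$\widehat{\mathrm{Isot}}_{\mathrm{fib}}(Z)=\left\{\mathrm{diag}(1,\theta_1,\theta_2)\ :\ (\theta_1,\theta_2)\in(\mathbb{C}^* )^2,\ (c_1,c_2)(\theta_1\theta_2v)=(c_1,c_2)(v)\right\}.$$
   Context: Coordinates on $\mathbb{C}^3$ are $(x,\mathbf y)=(x,y_1,y_2)$. $\widehat{\mathrm{Diff}}_{\mathrm{fib}}$ is the group of formal diffeomorphisms of $\mathbb{C}^3$ fixing the origin of the form $(x,\mathbf y)\mapsto(x,\phi(x,\mathbf y))$, acting on singular formal vector fields by $\Phi_*(X)=(\mathrm D\Phi\cdot X)\circ\Phi^{-1}$. For a singular formal vector field $X$, $\widehat{\mathrm{Isot}}_{\mathrm{fib}}(X):=\{\Phi\in\widehat{\mathrm{Diff}}_{\mathrm{fib}}:\Phi_*(X)=X\}$. The notation $\mathrm{diag}(1,\theta_1,\theta_2)$ stands for the linear map $(x,y_1,y_2)\mapsto(x,\theta_1y_1,\theta_2y_2)$. The condition $(c_1,c_2)(\theta_1\theta_2v)=(c_1,c_2)(v)$ is an identity of pairs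 of formal power series in $v$. *)

theory Defs
  imports Complex_Main "HOL-Computational_Algebra.Formal_Power_Series"
begin

unbundle fps_syntax

text \<open>
  Formal power series in \<open>(x, y\<^sub>1, y\<^sub>2)\<close> are iterated univariate series: the coefficient of
  \<open>x^i y\<^sub>1^j y\<^sub>2^k\<close> in \<open>F\<close> is \<open>F $ i $ j $ k\<close>.
\<close>

type_synonym fps3 = "complex fps fps fps"

definition scalar3 :: "complex \<Rightarrow> fps3" where
  "scalar3 a = fps_const (fps_const (fps_const a))"

definition var_x :: fps3 where
  "var_x = fps_X"

definition var_y1 :: fps3 where
  "var_y1 = fps_const fps_X"

definition var_y2 :: fps3 where
  "var_y2 = fps_const (fps_const fps_X)"

definition deriv_x :: "fps3 \<Rightarrow> fps3" where
  "deriv_x F = fps_deriv F"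

definition deriv_y1 :: "fps3 \<Rightarrow> fps3" where
  "deriv_y1 F = Abs_fps (\<lambda>i. fps_deriv (F $ i))"

definition deriv_y2 :: "fps3 \<Rightarrow> fps3" where
  "deriv_y2 F = Abs_fps (\<lambda>i. Abs_fps (\<lambda>j. fps_deriv (F $ i $ j)))"

text \<open>
  Triples of series represent both formal maps \<open>(\<Phi>\<^sub>1, \<Phi>\<^sub>2, \<Phi>\<^sub>3)\<close> and formal vector fields
  \<open>X\<^sub>1 \<partial>/\<partial>x + X\<^sub>2 \<partial>/\<partial>y\<^sub>1 + X\<^sub>3 \<partial>/\<partial>y\<^sub>2\<close>.
\<close>

type_synonym fps3_triple = "fps3 \<times> fps3 \<times> fps3"

text \<open>
  The triple has zero constant terms: a formal map fixes the origin, a formal vector field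
  is singular.
\<close>

definition vanishes_at_origin :: "fps3_triple \<Rightarrow> bool" where
  "vanishes_at_origin = (\<lambda>(F1, F2, F3). F1 $ 0 $ 0 $ 0 = 0 \<and> F2 $ 0 $ 0 $ 0 = 0 \<and> F3 $ 0 $ 0 $ 0 = 0)"

text \<open>
  Substitution of series without constant term, as for \<^const>\<open>fps_compose\<close>: the
  product \<open>G\<^sub>1^i G\<^sub>2^j G\<^sub>3^k\<close> has order at least \<open>i + j + k\<close>, so indices beyond \<open>l + m + n\<close>
  do not contribute to the coefficient of \<open>x^l y\<^sub>1^m y\<^sub>2^n\<close>.  The definitions are only
  meaningful when the substituted series have zero constant term.
\<close>

definition fps1_subst :: "complex fps \<Rightarrow> fps3 \<Rightarrow> fps3" where
  "fps1_subst c G = Abs_fps (\<lambda>l. Abs_fps (\<lambda>m. Abs_fps (\<lambda>n.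
     \<Sum>i\<le>l+m+n. c $ i * (G ^ i) $ l $ m $ n)))"

definition fps3_subst :: "fps3 \<Rightarrow> fps3_triple \<Rightarrow> fps3" where
  "fps3_subst F = (\<lambda>(G1, G2, G3). Abs_fps (\<lambda>l. Abs_fps (\<lambda>m. Abs_fps (\<lambda>n.
     \<Sum>i\<le>l+m+n. \<Sum>j\<le>l+m+n. \<Sum>k\<le>l+m+n. F $ i $ j $ k * (G1 ^ i * G2 ^ j * G3 ^ k) $ l $ m $ n))))"

definition triple_comp :: "fps3_triple \<Rightarrow> fps3_triple \<Rightarrow> fps3_triple" where
  "triple_comp = (\<lambda>(F1, F2, F3) G. (fps3_subst F1 G, fps3_subst F2 G, fps3_subst F3 G))"

definition id_map :: fps3_triple where
  "id_map = (var_x, var_y1, var_y2)"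

definition is_formal_inverse :: "fps3_triple \<Rightarrow> fps3_triple \<Rightarrow> bool" where
  "is_formal_inverse \<Phi> \<Psi> \<longleftrightarrow>
     vanishes_at_origin \<Psi> \<and> triple_comp \<Phi> \<Psi> = id_map \<and> triple_comp \<Psi> \<Phi> = id_map"

definition formal_diffeo :: "fps3_triple set" where
  "formal_diffeo = {\<Phi>. vanishes_at_origin \<Phi> \<and> (\<exists>\<Psi>. is_formal_inverse \<Phi> \<Psi>)}"

definition formal_diffeo_fib :: "fps3_triple set" where
  "formal_diffeo_fib = {\<Phi> \<in> formal_diffeo. fst \<Phi> = var_x}"

definition formal_inverse :: "fps3_triple \<Rightarrow> fps3_triple" where
  "formal_inverse \<Phi> = (THE \<Psi>. is_formal_inverse \<Phi> \<Psi>)"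

definition directional_deriv :: "fps3 \<Rightarrow> fps3_triple \<Rightarrow> fps3" where
  "directional_deriv F = (\<lambda>(X1, X2, X3). deriv_x F * X1 + deriv_y1 F * X2 + deriv_y2 F * X3)"

text \<open>The matrix-vector product \<open>D\<Phi> \<cdot> X\<close>, row by row.\<close>

definition jacobian_apply :: "fps3_triple \<Rightarrow> fps3_triple \<Rightarrow> fps3_triple" where
  "jacobian_apply = (\<lambda>(F1, F2, F3) X.
     (directional_deriv F1 X, directional_deriv F2 X, directional_deriv F3 X))"

definition pushforward :: "fps3_triple \<Rightarrow> fps3_triple \<Rightarrow> fps3_triple" where
  "pushforward \<Phi> X = triple_comp (jacobian_apply \<Phi> X) (formal_inverse \<Phi>)"

definition isot_fib :: "fps3_triple \<Rightarrow> fps3_triple set" where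
  "isot_fib X = {\<Phi> \<in> formal_diffeo_fib. pushforward \<Phi> X = X}"

definition diag_map :: "complex \<Rightarrow> complex \<Rightarrow> complex \<Rightarrow> fps3_triple" where
  "diag_map \<theta>0 \<theta>1 \<theta>2 = (scalar3 \<theta>0 * var_x, scalar3 \<theta>1 * var_y1, scalar3 \<theta>2 * var_y2)"

definition Z_field ::
  "complex \<Rightarrow> complex \<Rightarrow> complex \<Rightarrow> complex fps \<Rightarrow> complex fps \<Rightarrow> fps3_triple" where
  "Z_field lam a1 a2 c1 c2 =
     (var_x ^ 2,
      (- scalar3 lam + scalar3 a1 * var_x + fps1_subst c1 (var_y1 * var_y2)) * var_y1,
      (scalar3 lam + scalar3 a2 * var_x + fps1_subst c2 (var_y1 * var_y2)) * var_y2)"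

end

theory Submission
  imports Defs
begin

text \<open>
  A fibered \<open>\<Phi> = (x, \<phi>\<^sub>1, \<phi>\<^sub>2)\<close> fixes \<open>Z\<close> iff
  \<open>Z(\<phi>\<^sub>1) = (-\<lambda> + a\<^sub>1 x + c\<^sub>1(\<phi>\<^sub>1\<phi>\<^sub>2)) \<phi>\<^sub>1\<close> and
  \<open>Z(\<phi>\<^sub>2) = (\<lambda> + a\<^sub>2 x + c\<^sub>2(\<phi>\<^sub>1\<phi>\<^sub>2)) \<phi>\<^sub>2\<close>.  We solve this by induction on the degree \<open>D\<close> in
  \<open>y\<^sub>1, y\<^sub>2\<close>.  Degrees \<open>0\<close> and \<open>1\<close> give \<open>\<phi>\<^sub>i = \<theta>\<^sub>i y\<^sub>i + \<dots>\<close>.  If \<open>\<phi>\<^sub>i = \<theta>\<^sub>i y\<^sub>i\<close> below degree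
  \<open>D \<ge> 2\<close>, then \<open>c\<^sub>i(\<phi>\<^sub>1\<phi>\<^sub>2)\<close> may be replaced by \<open>c\<^sub>i(\<theta>\<^sub>1\<theta>\<^sub>2 y\<^sub>1y\<^sub>2)\<close> in degree \<open>D\<close>, so the coefficient
  \<open>P(x)\<close> of a monomial of degree \<open>D\<close> in \<open>\<phi>\<^sub>i\<close> satisfies \<open>x\<^sup>2P' + (\<kappa> + \<beta>x)P = K\<close> with constants
  \<open>\<kappa>, \<beta>, K\<close>.  For nonresonant monomials \<open>\<kappa> \<noteq> 0\<close> and \<open>K = 0\<close>, so \<open>P = 0\<close>.  For the resonant
  monomial \<open>(y\<^sub>1y\<^sub>2)\<^sup>n y\<^sub>i\<close> one has \<open>\<kappa> = 0\<close>, \<open>\<beta> = n(a\<^sub>1 + a\<^sub>2)\<close> and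
  \<open>K = \<theta>\<^sub>i c\<^sub>i\<^sub>,\<^sub>n((\<theta>\<^sub>1\<theta>\<^sub>2)\<^sup>n - 1)\<close>; setting \<open>x = 0\<close> gives \<open>K = 0\<close>, and then \<open>P = 0\<close> because
  \<open>m + n(a\<^sub>1 + a\<^sub>2) \<noteq> 0\<close> for all \<open>m \<ge> 0\<close>.
\<close>

section \<open>Coefficients of series in three variables\<close>

lemma fps3_eqI: "(\<And>i j k. F $ i $ j $ k = G $ i $ j $ k) \<Longrightarrow> F = (G :: fps3)"
  by (simp add: fps_eq_iff)

lemma fps3_mult_nth:
  "((F :: fps3) * G) $ l $ m $ n =
     (\<Sum>i\<le>l. \<Sum>j\<le>m. \<Sum>k\<le>n. F $ i $ j $ k * G $ (l - i) $ (m - j) $ (n - k))"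
  by (simp add: fps_mult_nth fps_sum_nth atLeast0AtMost)

lemma scalar3_mult_nth [simp]: "(scalar3 a * F) $ i $ j $ k = a * F $ i $ j $ k"
  by (simp add: scalar3_def)

lemma scalar3_hom:
  "scalar3 (a + b) = scalar3 a + scalar3 b" "scalar3 (a * b) = scalar3 a * scalar3 b"
  "scalar3 (a ^ n) = scalar3 a ^ n" "scalar3 1 = 1" "scalar3 0 = 0" "scalar3 (- a) = - scalar3 a"
  by (simp_all add: scalar3_def fps_const_power flip: fps_const_neg)

lemma var_x_mult_nth: "(var_x * F) $ i $ j $ k = (if i = 0 then 0 else F $ (i - 1) $ j $ k)"
  by (simp add: var_x_def)

subsection \<open>Weighted order of vanishing\<close>

text \<open>The weight of \<open>x\<close> is \<open>p\<close>: total degree for \<open>p = 1\<close>, degree in \<open>y\<^sub>1, y\<^sub>2\<close> for \<open>p = 0\<close>.\<close>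

definition vanish_below :: "nat \<Rightarrow> nat \<Rightarrow> fps3 \<Rightarrow> bool" where
  "vanish_below p n F \<longleftrightarrow> (\<forall>i j k. p * i + j + k < n \<longrightarrow> F $ i $ j $ k = 0)"

lemma vanish_belowD: "vanish_below p n F \<Longrightarrow> p * i + j + k < n \<Longrightarrow> F $ i $ j $ k = 0"
  by (simp add: vanish_below_def)

lemma vanish_below_mono: "vanish_below p n F \<Longrightarrow> m \<le> n \<Longrightarrow> vanish_below p m F"
  by (simp add: vanish_below_def)

lemma vanish_below_0 [simp]: "vanish_below p 0 F" "vanish_below p n 0"
  by (simp_all add: vanish_below_def)

lemma vanish_below_add: "vanish_below p n F \<Longrightarrow> vanish_below p n G \<Longrightarrow> vanish_below p n (F + G)"
  by (simp add: vanish_below_def)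

lemma vanish_below_diff: "vanish_below p n F \<Longrightarrow> vanish_below p n G \<Longrightarrow> vanish_below p n (F - G)"
  by (simp add: vanish_below_def)

lemma vanish_below_mult:
  assumes "vanish_below p a F" "vanish_below p b G"
  shows "vanish_below p (a + b) (F * G)"
  unfolding vanish_below_def
proof (intro allI impI)
  fix l m n assume less: "p * l + m + n < a + b"
  have "F $ i $ j $ k * G $ (l - i) $ (m - j) $ (n - k) = 0"
    if "i \<le> l" "j \<le> m" "k \<le> n" for i j k
  proof (cases "p * i + j + k < a")
    case True
    then show ?thesis using assms(1) by (simp add: vanish_below_def)
  next
    case False
    have "p * l = p * i + p * (l - i)" using that(1) by (simp flip: distrib_left)
    then have "p * (l - i) + (m - j) + (n - k) < b" using False less that by linarith
    then show ?thesis using assms(2) by (simp add: vanish_below_def)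
  qed
  then show "(F * G) $ l $ m $ n = 0" unfolding fps3_mult_nth by (intro sum.neutral ballI) simp
qed

lemma vanish_below_mult_left: "vanish_below p n F \<Longrightarrow> vanish_below p n (F * G)"
  using vanish_below_mult[of p n F 0 G] by simp

lemma vanish_below_mult_right: "vanish_below p n G \<Longrightarrow> vanish_below p n (F * G)"
  using vanish_below_mult[of p 0 F n G] by simp

lemma vanish_below_power: "vanish_below p 1 F \<Longrightarrow> vanish_below p n (F ^ n)"
  using vanish_below_mult[of p 1 F] by (induction n) auto

text \<open>Every coefficient sits at a finite weight, so agreement to all orders is equality. This
  replaces limits: with \<open>p = 1\<close> for identities about substitution, with
  \<open>p = 0\<close> for the final induction.\<close>

lemma fps3_eqI_vanish_below:
  assumes "\<And>n. vanish_below p n (F - G)"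
  shows "F = G"
proof (rule fps3_eqI)
  fix i j k
  have "(F - G) $ i $ j $ k = 0"
    using assms[of "Suc (p * i + j + k)"] by (rule vanish_belowD) simp
  then show "F $ i $ j $ k = G $ i $ j $ k" by simp
qed

subsection \<open>Monomials and truncations\<close>

definition mono3 :: "complex \<Rightarrow> nat \<Rightarrow> nat \<Rightarrow> nat \<Rightarrow> fps3" where
  "mono3 a i j k = scalar3 a * var_x ^ i * var_y1 ^ j * var_y2 ^ k"

lemma mono3_nth: "mono3 a i j k $ l $ m $ n = (if l = i \<and> m = j \<and> n = k then a else 0)"
proof -
  have "mono3 a i j k = fps_const (fps_const (fps_const a * fps_X ^ k) * fps_X ^ j) * fps_X ^ i"
    by (simp add: mono3_def scalar3_def var_x_def var_y1_def var_y2_def fps_const_power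
        mult_ac flip: fps_const_mult)
  then show ?thesis
    by (auto simp: fps_X_power_mult_right_nth)
qed

lemma mono3_mult: "mono3 a i j k * mono3 b i' j' k' = mono3 (a * b) (i + i') (j + j') (k + k')"
  by (simp add: mono3_def scalar3_hom power_add mult_ac)

text \<open>Cutting at a cube of exponents keeps a finite sum of monomials, while the remainder
  still has total order above \<open>N\<close>.\<close>

definition trunc3 :: "nat \<Rightarrow> fps3 \<Rightarrow> fps3" where
  "trunc3 N F = (\<Sum>i\<le>N. \<Sum>j\<le>N. \<Sum>k\<le>N. mono3 (F $ i $ j $ k) i j k)"

lemma sum_if_conj3:
  "(\<Sum>i\<le>N. \<Sum>j\<le>N. \<Sum>k\<le>N. if l = i \<and> m = j \<and> n = k then f i j k else 0) =
   (if l \<le> N \<and> m \<le> N \<and> n \<le> (N :: nat) then f l m n else (0 :: complex))"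
proof -
  have "(\<Sum>k\<le>N. if l = i \<and> m = j \<and> n = k then f i j k else 0) =
      (if m = j then if l = i \<and> n \<le> N then f i j n else 0 else 0)" for i j
    by (cases "l = i \<and> m = j") auto
  moreover have "(\<Sum>j\<le>N. if m = j then if l = i \<and> n \<le> N then f i j n else 0 else 0) =
      (if l = i then if m \<le> N \<and> n \<le> N then f i m n else 0 else 0)" for i
    by simp
  ultimately show ?thesis by simp
qed

lemma vanish_below_diff_trunc3: "vanish_below 1 (Suc N) (F - trunc3 N F)"
  by (simp add: vanish_below_def trunc3_def fps_sum_nth mono3_nth sum_if_conj3)

subsection \<open>Substitution is a ring homomorphism\<close>

lemma fps3_subst_nth:
  "fps3_subst F (G1, G2, G3) $ l $ m $ n =
     (\<Sum>i\<le>l+m+n. \<Sum>j\<le>l+m+n. \<Sum>k\<le>l+m+n. F $ i $ j $ k * (G1 ^ i * G2 ^ j * G3 ^ k) $ l $ m $ n)"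
  by (simp add: fps3_subst_def)

lemma fps3_subst_add: "fps3_subst (F + H) G = fps3_subst F G + fps3_subst H G"
  by (cases G) (auto intro!: fps3_eqI simp: fps3_subst_nth ring_distribs sum.distrib)

lemma fps3_subst_diff: "fps3_subst (F - H) G = fps3_subst F G - fps3_subst H G"
  by (cases G) (auto intro!: fps3_eqI simp: fps3_subst_nth ring_distribs sum_subtractf)

lemma fps3_subst_0 [simp]: "fps3_subst 0 G = 0"
  by (cases G) (auto intro!: fps3_eqI simp: fps3_subst_nth)

lemma fps3_subst_sum: "fps3_subst (sum f A) G = (\<Sum>x\<in>A. fps3_subst (f x) G)"
  by (induction A rule: infinite_finite_induct) (auto simp: fps3_subst_add)

lemma vanishes_at_origin_iff:
  "vanishes_at_origin (G1, G2, G3) \<longleftrightarrow>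
     vanish_below 1 1 G1 \<and> vanish_below 1 1 G2 \<and> vanish_below 1 1 G3"
  by (auto simp: vanishes_at_origin_def vanish_below_def)

lemma vanish_below_monomial:
  assumes "vanishes_at_origin (G1, G2, G3)"
  shows "vanish_below 1 (i + j + k) (G1 ^ i * G2 ^ j * G3 ^ k)"
  using assms by (intro vanish_below_mult vanish_below_power) (auto simp: vanishes_at_origin_iff)

text \<open>A monomial of degree \<open>d\<close> becomes a product of order at least
  \<open>d\<close>, so low coefficients of the result only see low coefficients of
  \<open>F\<close>.\<close>

lemma vanish_below_fps3_subst:
  assumes G: "vanishes_at_origin G" and F: "vanish_below 1 n F"
  shows "vanish_below 1 n (fps3_subst F G)"
proof -
  obtain G1 G2 G3 where G_eq: "G = (G1, G2, G3)" by (cases G)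
  have "F $ i $ j $ k * (G1 ^ i * G2 ^ j * G3 ^ k) $ a $ b $ c = 0" if "a + b + c < n" for a b c i j k
  proof (cases "i + j + k < n")
    case True
    then show ?thesis using F by (simp add: vanish_below_def)
  next
    case False
    then show ?thesis
      using vanish_belowD[OF vanish_below_monomial[of G1 G2 G3 i j k], of a b c] G that by (simp add: G_eq)
  qed
  then show ?thesis unfolding vanish_below_def G_eq fps3_subst_nth
    by (intro allI impI sum.neutral ballI) simp
qed

lemma fps3_subst_mono3:
  assumes "vanishes_at_origin (G1, G2, G3)"
  shows "fps3_subst (mono3 a i j k) (G1, G2, G3) = scalar3 a * (G1 ^ i * G2 ^ j * G3 ^ k)"
proof (rule fps3_eqI)
  fix l m n :: nat
  let ?N = "l + m + n"
  have "fps3_subst (mono3 a i j k) (G1, G2, G3) $ l $ m $ n =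
    (\<Sum>i'\<le>?N. \<Sum>j'\<le>?N. \<Sum>k'\<le>?N. if i = i' \<and> j = j' \<and> k = k'
        then a * (G1 ^ i' * G2 ^ j' * G3 ^ k') $ l $ m $ n else 0)"
    unfolding fps3_subst_nth by (intro sum.cong refl) (auto simp: mono3_nth)
  also have "\<dots> = a * (G1 ^ i * G2 ^ j * G3 ^ k) $ l $ m $ n"
    \<comment> \<open>If an exponent exceeds \<open>l + m + n\<close>, the sum is empty; the
      monomial then has order above \<open>l + m + n\<close>, so its coefficient is zero
      too.\<close>
    unfolding sum_if_conj3
    using vanish_belowD[OF vanish_below_monomial[OF assms, of i j k], of l m n] by auto
  finally show "fps3_subst (mono3 a i j k) (G1, G2, G3) $ l $ m $ n =
      (scalar3 a * (G1 ^ i * G2 ^ j * G3 ^ k)) $ l $ m $ n" by simp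
qed

text \<open>On monomials this is the law of exponents, and bilinearity extends it to truncations.
  The remainders have order above \<open>n\<close>, which substitution does not lower.\<close>

lemma fps3_subst_mult:
  assumes G: "vanishes_at_origin G"
  shows "fps3_subst (F * H) G = fps3_subst F G * fps3_subst H G"
proof (rule fps3_eqI_vanish_below)
  fix n
  let ?S = "\<lambda>F. fps3_subst F G" and ?T = "trunc3 n"
  obtain G1 G2 G3 where G_eq: "G = (G1, G2, G3)" by (cases G)
  have "?S (mono3 a i j k * mono3 b i' j' k') = ?S (mono3 a i j k) * ?S (mono3 b i' j' k')"
    for a b i j k i' j' k'
    using G by (simp add: G_eq mono3_mult fps3_subst_mono3 scalar3_hom power_add mult_ac)
  then have T: "?S (?T F * ?T H) = ?S (?T F) * ?S (?T H)"
    unfolding trunc3_def by (simp add: fps3_subst_sum sum_distrib_left sum_distrib_right)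
  have S: "?S F = ?S (?T F) + ?S (F - ?T F)" for F
    by (simp flip: fps3_subst_add)
  have "F * H = ?T F * ?T H + (?T F * (H - ?T H) + (F - ?T F) * H)"
    by (simp add: algebra_simps)
  then have 1: "?S (F * H) = ?S (?T F * ?T H) + ?S (?T F * (H - ?T H) + (F - ?T F) * H)"
    by (metis fps3_subst_add)
  have 2: "?S F * ?S H =
      ?S (?T F) * ?S (?T H) + (?S (?T F) * ?S (H - ?T H) + ?S (F - ?T F) * ?S H)"
    by (simp add: fps3_subst_diff algebra_simps)
  have "vanish_below 1 (Suc n) (?S (F * H) - ?S F * ?S H)"
    unfolding 1 2 T add_diff_cancel_left
    by (intro vanish_below_diff vanish_below_fps3_subst[OF G] vanish_below_add
        vanish_below_mult_left vanish_below_fps3_subst[OF G] vanish_below_diff_trunc3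
        vanish_below_mult_right[OF vanish_below_fps3_subst[OF G vanish_below_diff_trunc3]]
        vanish_below_mult_right[OF vanish_below_diff_trunc3])
  then show "vanish_below 1 n (?S (F * H) - ?S F * ?S H)"
    by (rule vanish_below_mono) simp
qed

lemma fps3_subst_scalar3:
  assumes "vanishes_at_origin G"
  shows "fps3_subst (scalar3 a) G = scalar3 a"
  using assms fps3_subst_mono3[of "fst G" "fst (snd G)" "snd (snd G)" a 0 0 0]
  by (simp add: mono3_def)

lemma fps3_subst_var:
  assumes "vanishes_at_origin (G1, G2, G3)"
  shows "fps3_subst var_x (G1, G2, G3) = G1"
    and "fps3_subst var_y1 (G1, G2, G3) = G2"
    and "fps3_subst var_y2 (G1, G2, G3) = G3"
  using fps3_subst_mono3[OF assms, of 1 1 0 0] fps3_subst_mono3[OF assms, of 1 0 1 0]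
    fps3_subst_mono3[OF assms, of 1 0 0 1]
  by (simp_all add: mono3_def scalar3_hom)

lemma fps3_subst_power:
  assumes "vanishes_at_origin G"
  shows "fps3_subst (F ^ n) G = fps3_subst F G ^ n"
  using fps3_subst_scalar3[OF assms, of 1] fps3_subst_mult[OF assms]
  by (induction n) (simp_all add: scalar3_hom)

lemma fps3_subst_uminus: "fps3_subst (- F) G = - fps3_subst F G"
  using fps3_subst_diff[of 0 F G] by simp

subsection \<open>Composition of formal maps\<close>

lemma vanishes_at_origin_triple_comp:
  assumes "vanishes_at_origin F" "vanishes_at_origin G"
  shows "vanishes_at_origin (triple_comp F G)"
  using assms(1) vanish_below_fps3_subst[OF assms(2)]
  by (cases F) (auto simp: triple_comp_def vanishes_at_origin_iff)

lemma fps3_subst_triple_comp: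
  assumes G: "vanishes_at_origin G" and H: "vanishes_at_origin H"
  shows "fps3_subst (fps3_subst F G) H = fps3_subst F (triple_comp G H)"
proof (rule fps3_eqI_vanish_below)
  fix n
  obtain G1 G2 G3 where G_eq: "G = (G1, G2, G3)" by (cases G)
  let ?S = "\<lambda>F. fps3_subst (fps3_subst F G) H" and ?T = "\<lambda>F. fps3_subst F (triple_comp G H)"
  note GH = vanishes_at_origin_triple_comp[OF G H]
  have "?S (mono3 a i j k) = ?T (mono3 a i j k)" for a i j k
    using G GH unfolding G_eq triple_comp_def
    by (simp add: fps3_subst_mono3 fps3_subst_mult[OF H] fps3_subst_power[OF H]
        fps3_subst_scalar3[OF H])
  then have "?S (trunc3 n F) = ?T (trunc3 n F)"
    unfolding trunc3_def by (simp add: fps3_subst_sum)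
  then have "?S F - ?T F = ?S (F - trunc3 n F) - ?T (F - trunc3 n F)"
    by (simp add: fps3_subst_diff)
  moreover have "vanish_below 1 (Suc n) (?S (F - trunc3 n F) - ?T (F - trunc3 n F))"
    by (intro vanish_below_diff vanish_below_fps3_subst G H GH vanish_below_diff_trunc3)
  ultimately show "vanish_below 1 n (?S F - ?T F)"
    by (metis vanish_below_mono le_Suc_eq order_refl)
qed

lemma triple_comp_assoc:
  assumes "vanishes_at_origin G" "vanishes_at_origin H"
  shows "triple_comp (triple_comp F G) H = triple_comp F (triple_comp G H)"
  using fps3_subst_triple_comp[OF assms] by (cases F) (simp add: triple_comp_def)

lemma vanishes_at_origin_id_map: "vanishes_at_origin id_map"
  by (simp add: vanishes_at_origin_def id_map_def var_x_def var_y1_def var_y2_def)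

lemma fps3_subst_id_map: "fps3_subst F id_map = F"
proof (rule fps3_eqI_vanish_below)
  fix n
  have "fps3_subst (mono3 a i j k) id_map = mono3 a i j k" for a i j k
    using fps3_subst_mono3[OF vanishes_at_origin_id_map[unfolded id_map_def], of a i j k]
    by (simp add: id_map_def) (simp add: mono3_def mult_ac)
  then have "fps3_subst (trunc3 n F) id_map = trunc3 n F"
    unfolding trunc3_def by (simp add: fps3_subst_sum)
  then have "fps3_subst F id_map - F = fps3_subst (F - trunc3 n F) id_map - (F - trunc3 n F)"
    by (simp add: fps3_subst_diff)
  moreover have "vanish_below 1 (Suc n) (fps3_subst (F - trunc3 n F) id_map - (F - trunc3 n F))"
    by (intro vanish_below_diff vanish_below_fps3_subst vanishes_at_origin_id_map
        vanish_below_diff_trunc3)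
  ultimately show "vanish_below 1 n (fps3_subst F id_map - F)"
    by (metis vanish_below_mono le_Suc_eq order_refl)
qed

lemma triple_comp_id_map_right [simp]: "triple_comp F id_map = F"
  by (cases F) (simp add: triple_comp_def fps3_subst_id_map)

lemma triple_comp_id_map_left: "vanishes_at_origin G \<Longrightarrow> triple_comp id_map G = G"
  by (cases G) (simp add: triple_comp_def id_map_def fps3_subst_var)

lemma is_formal_inverse_unique:
  assumes "vanishes_at_origin \<Phi>" "is_formal_inverse \<Phi> \<Psi>" "is_formal_inverse \<Phi> \<Psi>'"
  shows "\<Psi> = \<Psi>'"
  using assms triple_comp_assoc[of \<Phi> \<Psi>' \<Psi>] triple_comp_id_map_left
  unfolding is_formal_inverse_def by auto

lemma is_formal_inverse_formal_inverse:
  assumes "\<Phi> \<in> formal_diffeo"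
  shows "is_formal_inverse \<Phi> (formal_inverse \<Phi>)"
proof -
  have "\<exists>!\<Psi>. is_formal_inverse \<Phi> \<Psi>"
    using assms is_formal_inverse_unique unfolding formal_diffeo_def by blast
  then show ?thesis unfolding formal_inverse_def by (rule theI')
qed

text \<open>Composing with \<open>\<Phi>\<close> on the right removes the inverse, so isotropy
  becomes the equation \<open>D\<Phi> \<cdot> X = X \<circ> \<Phi>\<close>.\<close>

lemma pushforward_eq_iff:
  assumes "\<Phi> \<in> formal_diffeo"
  shows "pushforward \<Phi> X = Y \<longleftrightarrow> jacobian_apply \<Phi> X = triple_comp Y \<Phi>"
proof -
  note inv = is_formal_inverse_formal_inverse[OF assms]
  have \<Phi>: "vanishes_at_origin \<Phi>" using assms by (simp add: formal_diffeo_def)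
  show ?thesis
    using inv \<Phi> triple_comp_assoc unfolding pushforward_def is_formal_inverse_def
    by (metis triple_comp_id_map_right)
qed


subsection \<open>Substitution into univariate series\<close>

lemma fps1_subst_nth:
  "fps1_subst c G $ l $ m $ n = (\<Sum>i\<le>l+m+n. c $ i * (G ^ i) $ l $ m $ n)"
  by (simp add: fps1_subst_def)

lemma vanish_below_fps1_subst:
  assumes "c $ 0 = 0" "vanish_below p n G"
  shows "vanish_below p n (fps1_subst c G)"
proof -
  have "vanish_below p n (G ^ i)" if "i \<noteq> 0" for i
    using that assms(2) by (cases i) (auto intro: vanish_below_mult_left)
  then have "c $ i * (G ^ i) $ l $ m $ k = 0" if "p * l + m + k < n" for i l m k
    using that assms(1) by (cases "i = 0") (auto simp: vanish_below_def)
  then show ?thesis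
    unfolding vanish_below_def fps1_subst_nth by (intro allI impI sum.neutral ballI) simp
qed

text \<open>\<open>G - H\<close> divides each \<open>G ^ i - H ^ i\<close>.\<close>

lemma vanish_below_fps1_subst_diff:
  assumes "vanish_below p n (G - H)"
  shows "vanish_below p n (fps1_subst c G - fps1_subst c H)"
proof -
  have "vanish_below p n (G ^ i - H ^ i)" for i
    unfolding power_diff_sumr2 by (rule vanish_below_mult_left[OF assms])
  then have "c $ i * (G ^ i - H ^ i) $ l $ m $ k = 0" if "p * l + m + k < n" for i l m k
    using that by (simp add: vanish_below_def)
  then show ?thesis
    unfolding vanish_below_def fps_sub_nth fps1_subst_nth sum_subtractf[symmetric]
      right_diff_distrib[symmetric]
    by (intro allI impI sum.neutral ballI) simp
qed

lemma vanish_below_fps1_subst_sum: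
  assumes "vanish_below 1 1 G"
  shows "vanish_below 1 (Suc N) (fps1_subst c G - (\<Sum>i\<le>N. scalar3 (c $ i) * G ^ i))"
proof -
  have "fps1_subst c G $ l $ m $ n = (\<Sum>i\<le>N. c $ i * (G ^ i) $ l $ m $ n)"
    if "l + m + n < Suc N" for l m n
    unfolding fps1_subst_nth
    using that vanish_belowD[OF vanish_below_power[OF assms], of l m n]
    by (intro sum.mono_neutral_left) auto
  then show ?thesis by (simp add: vanish_below_def fps_sum_nth)
qed

lemma fps3_subst_fps1_subst:
  assumes H: "vanishes_at_origin H" and G: "vanish_below 1 1 G"
  shows "fps3_subst (fps1_subst c G) H = fps1_subst c (fps3_subst G H)"
proof (rule fps3_eqI_vanish_below)
  fix n
  let ?P = "\<lambda>G. \<Sum>i\<le>n. scalar3 (c $ i) * G ^ i"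
  have "fps3_subst (?P G) H = ?P (fps3_subst G H)"
    by (simp add: fps3_subst_sum fps3_subst_mult[OF H] fps3_subst_power[OF H]
        fps3_subst_scalar3[OF H])
  then have "fps3_subst (fps1_subst c G) H - fps1_subst c (fps3_subst G H) =
    fps3_subst (fps1_subst c G - ?P G) H - (fps1_subst c (fps3_subst G H) - ?P (fps3_subst G H))"
    by (simp add: fps3_subst_diff)
  moreover have "vanish_below 1 (Suc n) \<dots>"
    by (intro vanish_below_diff[OF vanish_below_fps3_subst[OF H] _] vanish_below_fps1_subst_sum
        vanish_below_fps3_subst[OF H] G)
  ultimately show "vanish_below 1 n (fps3_subst (fps1_subst c G) H - fps1_subst c (fps3_subst G H))"
    by (metis vanish_below_mono le_Suc_eq order_refl)
qed

lemma fps1_subst_scaled_nth: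
  "fps1_subst c (scalar3 \<theta> * (var_y1 * var_y2)) $ i $ j $ k =
     (if i = 0 \<and> j = k then c $ j * \<theta> ^ j else 0)"
proof -
  have "(scalar3 \<theta> * (var_y1 * var_y2)) ^ n = mono3 (\<theta> ^ n) 0 n n" for n
    by (simp add: mono3_def scalar3_hom power_mult_distrib mult_ac)
  then have "fps1_subst c (scalar3 \<theta> * (var_y1 * var_y2)) $ i $ j $ k =
      (\<Sum>n\<le>i+j+k. if j = n then if i = 0 \<and> j = k then c $ j * \<theta> ^ j else 0 else 0)"
    unfolding fps1_subst_nth by (intro sum.cong refl) (auto simp: mono3_nth)
  then show ?thesis by simp
qed

lemma fps1_subst_y1_y2_nth:
  "fps1_subst c (var_y1 * var_y2) $ i $ j $ k = (if i = 0 \<and> j = k then c $ j else 0)"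
  using fps1_subst_scaled_nth[of c 1] by (simp add: scalar3_hom)

subsection \<open>Coefficients of the directional derivative\<close>

lemma deriv_x_mult_nth:
  "(deriv_x F * var_x ^ 2) $ i $ j $ k =
     (if i = 0 then 0 else (of_nat i - 1) * F $ (i - 1) $ j $ k)"
proof -
  consider "i = 0" | "i = 1" | n where "i = Suc (Suc n)"
    by (metis One_nat_def not0_implies_Suc)
  then show ?thesis
    by cases (simp_all add: deriv_x_def var_x_def power2_eq_square flip: mult.assoc fps_of_nat)
qed

lemma deriv_y1_mult_nth: "(deriv_y1 F * var_y1) $ i $ j $ k = of_nat j * F $ i $ j $ k"
  by (cases j) (simp_all add: deriv_y1_def var_y1_def flip: fps_of_nat)

lemma deriv_y2_mult_nth: "(deriv_y2 F * var_y2) $ i $ j $ k = of_nat k * F $ i $ j $ k"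
  by (cases k) (simp_all add: deriv_y2_def var_y2_def)

text \<open>The grouping exposes the Euler operators
  \<open>y\<^sub>i \<partial>/\<partial>y\<^sub>i\<close>, which are diagonal on monomials.\<close>

lemma directional_deriv_Z_field:
  "directional_deriv F (Z_field lam a1 a2 c1 c2) =
     deriv_x F * var_x ^ 2
     + (- scalar3 lam + scalar3 a1 * var_x) * (deriv_y1 F * var_y1)
     + (scalar3 lam + scalar3 a2 * var_x) * (deriv_y2 F * var_y2)
     + (fps1_subst c1 (var_y1 * var_y2) * (deriv_y1 F * var_y1)
       + fps1_subst c2 (var_y1 * var_y2) * (deriv_y2 F * var_y2))"
  by (simp add: directional_deriv_def Z_field_def algebra_simps)

text \<open>On the left, \<open>j\<close> and \<open>k\<close> stay fixed and only the power of
  \<open>x\<close> shifts: one linear recursion per monomial in \<open>y\<^sub>1, y\<^sub>2\<close>.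
  The terms that mix monomials are on the right.\<close>

lemma eigen_equation_nth:
  assumes "directional_deriv F (Z_field lam a1 a2 c1 c2) =
     (scalar3 \<mu> + scalar3 b * var_x + C) * F"
  shows "(lam * (of_nat k - of_nat j) - \<mu>) * F $ i $ j $ k
     + (if i = 0 then 0 else
          (of_nat i - 1 + a1 * of_nat j + a2 * of_nat k - b) * F $ (i - 1) $ j $ k) =
     (C * F - (fps1_subst c1 (var_y1 * var_y2) * (deriv_y1 F * var_y1)
       + fps1_subst c2 (var_y1 * var_y2) * (deriv_y2 F * var_y2))) $ i $ j $ k"
    (is "_ = (C * F - ?E) $ i $ j $ k")
proof -
  define E where "E = ?E"
  have "(directional_deriv F (Z_field lam a1 a2 c1 c2)) $ i $ j $ k =
    ((scalar3 \<mu> + scalar3 b * var_x + C) * F) $ i $ j $ k"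
    by (simp add: assms)
  then show ?thesis
    unfolding directional_deriv_Z_field E_def[symmetric]
    by (simp add: distrib_right left_diff_distrib mult.assoc var_x_mult_nth deriv_x_mult_nth
        deriv_y1_mult_nth deriv_y2_mult_nth split: if_splits) (simp_all add: algebra_simps)
qed

subsection \<open>Solving the eigenvalue equation degree by degree\<close>

lemma mult_mono3_nth:
  "(G * mono3 s i j k) $ l $ m $ n =
     (if i \<le> l \<and> j \<le> m \<and> k \<le> n then s * G $ (l - i) $ (m - j) $ (n - k) else 0)"
proof -
  have eq: "G * mono3 s i j k =
      scalar3 s * (G * fps_X ^ i * fps_const (fps_X ^ j) * fps_const (fps_const (fps_X ^ k)))"
    by (simp add: mono3_def var_x_def var_y1_def var_y2_def fps_const_power mult_ac)
  show ?thesis unfolding eq by (simp add: fps_X_power_mult_right_nth)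
qed

lemma vanish_below_mono3: "n \<le> p * i + j + k \<Longrightarrow> vanish_below p n (mono3 a i j k)"
  by (auto simp: vanish_below_def mono3_nth)

lemma vanish_below_euler:
  assumes "vanish_below 0 n F"
  shows "vanish_below 0 n (deriv_y1 F * var_y1)" "vanish_below 0 n (deriv_y2 F * var_y2)"
  using assms by (simp_all add: vanish_below_def deriv_y1_mult_nth deriv_y2_mult_nth)

lemma euler_diff:
  "deriv_y1 (F - G) * var_y1 = deriv_y1 F * var_y1 - deriv_y1 G * var_y1"
  "deriv_y2 (F - G) * var_y2 = deriv_y2 F * var_y2 - deriv_y2 G * var_y2"
  by (rule fps3_eqI; simp only: fps_sub_nth deriv_y1_mult_nth deriv_y2_mult_nth right_diff_distrib)+

lemma euler_mono3:
  "deriv_y1 (mono3 s i j k) * var_y1 = mono3 (of_nat j * s) i j k"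
  "deriv_y2 (mono3 s i j k) * var_y2 = mono3 (of_nat k * s) i j k"
  by (rule fps3_eqI; auto simp only: deriv_y1_mult_nth deriv_y2_mult_nth mono3_nth mult_zero_right
      split: if_splits)+

lemma vanish_below_fps1_subst_scaled:
  "c $ 0 = 0 \<Longrightarrow> vanish_below 0 2 (fps1_subst c (scalar3 \<theta> * (var_y1 * var_y2)))"
  "c $ 0 = 0 \<Longrightarrow> vanish_below 0 2 (fps1_subst c (var_y1 * var_y2))"
  by (auto simp: vanish_below_def fps1_subst_scaled_nth fps1_subst_y1_y2_nth less_2_cases_iff
      add_eq_if)

lemma nonresonant_recursion:
  fixes P \<beta> :: "nat \<Rightarrow> complex"
  assumes "\<kappa> \<noteq> 0" "\<And>i. \<kappa> * P i + (if i = 0 then 0 else \<beta> i * P (i - 1)) = 0"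
  shows "P i = 0"
proof (induction i)
  case 0
  then show ?case using assms(1) assms(2)[of 0] by simp
next
  case (Suc i)
  then show ?case using assms(1) assms(2)[of "Suc i"] by simp
qed

text \<open>
  \<open>(p, q)\<close> is \<open>(1, 0)\<close> for \<open>F = \<phi>\<^sub>1\<close> and \<open>(0, 1)\<close> for \<open>F = \<phi>\<^sub>2\<close>, so that \<open>y\<^sub>1^p y\<^sub>2^q\<close> is the expected leading
  monomial; \<open>C\<close> stands for \<open>c(\<phi>\<^sub>1\<phi>\<^sub>2)\<close>.
\<close>

locale Z_eigen =
  fixes lam a1 a2 :: complex and c1 c2 c :: "complex fps" and p q :: nat and F C :: fps3
  assumes lam: "lam \<noteq> 0" and c1: "c1 $ 0 = 0" and c2: "c2 $ 0 = 0"
    and pq: "p + q = 1"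
    and c: "\<And>n. c $ n = of_nat p * c1 $ n + of_nat q * c2 $ n"
    and nonres: "\<And>n i :: nat. n > 0 \<Longrightarrow> of_nat i + of_nat n * (a1 + a2) \<noteq> 0"
    and eigen: "directional_deriv F (Z_field lam a1 a2 c1 c2) =
      (scalar3 (lam * (of_nat q - of_nat p))
        + scalar3 (a1 * of_nat p + a2 * of_nat q) * var_x + C) * F"
begin

text \<open>Once \<open>C\<close> has y-degree at least 2, the part of \<open>R\<close> in degree
  \<open>D\<close> involves \<open>F\<close> only in degrees at most \<open>D - 2\<close>.\<close>

definition R :: fps3 where
  "R = C * F - (fps1_subst c1 (var_y1 * var_y2) * (deriv_y1 F * var_y1)
         + fps1_subst c2 (var_y1 * var_y2) * (deriv_y2 F * var_y2))"

lemma coeff_equation: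
  "lam * (of_nat k - of_nat j - (of_nat q - of_nat p)) * F $ i $ j $ k
     + (if i = 0 then 0 else
          (of_nat i - 1 + a1 * (of_nat j - of_nat p) + a2 * (of_nat k - of_nat q))
            * F $ (i - 1) $ j $ k) = R $ i $ j $ k"
  using eigen_equation_nth[OF eigen, of k j i] unfolding R_def[symmetric]
  by (simp add: algebra_simps split: if_splits)

lemma nonresonant_coeff:
  assumes "k + p \<noteq> j + q" "\<And>i. R $ i $ j $ k = 0"
  shows "F $ i $ j $ k = 0"
proof (rule nonresonant_recursion[where P = "\<lambda>i. F $ i $ j $ k"
      and \<beta> = "\<lambda>i. of_nat i - 1 + a1 * (of_nat j - of_nat p) + a2 * (of_nat k - of_nat q)"])
  have "of_nat (k + p) \<noteq> (of_nat (j + q) :: complex)"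
    using assms(1) unfolding of_nat_eq_iff .
  then have "of_nat k - of_nat j - (of_nat q - of_nat p) \<noteq> (0 :: complex)"
    by (simp add: algebra_simps)
  then show "lam * (of_nat k - of_nat j - (of_nat q - of_nat p)) \<noteq> 0"
    using lam by simp
qed (use coeff_equation[of k j] assms(2) in presburger)

text \<open>A fibered map need not preserve the axis \<open>y = 0\<close> a priori, so this is
  proved by induction on the power of \<open>x\<close>.\<close>

lemma vanish_below_1:
  assumes "C $ 0 $ 0 $ 0 = 0"
  shows "vanish_below 0 1 F"
proof -
  have "F $ i $ 0 $ 0 = 0" for i
  proof (induction i rule: less_induct)
    case (less i)
    have "vanish_below 0 2 (C * F - R)"
      unfolding R_def diff_diff_eq2 add_diff_cancel_left'
      by (intro vanish_below_add vanish_below_mult_left vanish_below_fps1_subst_scaled c1 c2)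
    then have "R $ i $ 0 $ 0 = (C * F) $ i $ 0 $ 0"
      by (simp add: vanish_below_def)
    also have "\<dots> = (\<Sum>l\<le>i. C $ l $ 0 $ 0 * F $ (i - l) $ 0 $ 0)"
      by (simp add: fps3_mult_nth)
    also have "\<dots> = 0"
    proof (intro sum.neutral ballI)
      \<comment> \<open>For \<open>l = 0\<close> the factor from \<open>C\<close> is its constant
        term, which is zero; otherwise the induction hypothesis applies to \<open>F\<close>.\<close>
      fix l
      show "C $ l $ 0 $ 0 * F $ (i - l) $ 0 $ 0 = 0" if "l \<in> {..i}"
        using that assms less[of "i - l"] by (cases "l = 0") auto
    qed
    finally have "R $ i $ 0 $ 0 = 0" .
    \<comment> \<open>Hence \<open>\<kappa> = lam * (p - q)\<close> is nonzero in degree 0.\<close>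
    moreover have "of_nat p \<noteq> (of_nat q :: complex)" using pq unfolding of_nat_eq_iff by presburger
    ultimately show ?case
      using coeff_equation[of 0 0 i] lam less[of "i - 1"] by (auto split: if_splits)
  qed
  then show ?thesis by (simp add: vanish_below_def)
qed

lemma vanish_below_2:
  assumes F: "vanish_below 0 1 F" and C: "vanish_below 0 2 C"
  shows "vanish_below 0 2 (F - mono3 (F $ 0 $ p $ q) 0 p q)"
  unfolding vanish_below_def
proof (intro allI impI)
  have "vanish_below 0 (2 + 1) R"
    unfolding R_def
    by (intro vanish_below_diff vanish_below_add vanish_below_mult C F vanish_below_euler
        vanish_below_fps1_subst_scaled c1 c2)
  then have R: "R $ i $ j $ k = 0" if "j + k < 3" for i j k
    using that by (simp add: vanish_below_def)
  fix i j k :: nat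
  assume "0 * i + j + k < 2"
  then consider "j = 0" "k = 0" | "j = p" "k = q" | "j + k = 1" "k + p \<noteq> j + q"
    using pq by fastforce
  then show "(F - mono3 (F $ 0 $ p $ q) 0 p q) $ i $ j $ k = 0"
  proof cases
    case 1
    then show ?thesis using F pq by (auto simp: vanish_below_def mono3_nth)
  next
    case 2
    \<comment> \<open>For the leading monomial \<open>\<kappa> = \<beta> = 0\<close>, so the
      equation at \<open>x^(i+1)\<close> reads \<open>i * F $ i $ p $ q = 0\<close>; only the
      coefficient at \<open>i = 0\<close> stays free.\<close>
    have "F $ i $ p $ q = 0" if "i > 0"
      using coeff_equation[of q p "Suc i"] R[of p q "Suc i"] pq that by simp
    then show ?thesis by (simp add: 2 mono3_nth)
  next
    case 3
    then have "F $ i $ j $ k = 0" by (intro nonresonant_coeff R) auto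
    then show ?thesis using 3 by (auto simp: mono3_nth)
  qed
qed

text \<open>Up to y-degree \<open>D\<close>, \<open>F\<close> and \<open>C\<close> may be replaced
  by their leading models: an error of order \<open>D\<close> in \<open>F\<close> meets a factor of
  order 2, and one in \<open>C\<close> meets \<open>F\<close>, of order 1. What remains is explicit
  because \<open>p * c1 + q * c2 = c\<close>.\<close>

lemma R_leading:
  assumes D: "D \<ge> 1" and F: "vanish_below 0 D (F - mono3 s 0 p q)"
    and C: "vanish_below 0 D (C - fps1_subst c (scalar3 \<theta> * (var_y1 * var_y2)))"
    and jk: "j + k = D"
  shows "R $ i $ j $ k =
    (if i = 0 \<and> p \<le> j \<and> q \<le> k \<and> j - p = k - q then s * (c $ (j - p) * (\<theta> ^ (j - p) - 1)) else 0)"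
proof -
  let ?M = "mono3 s 0 p q" and ?v = "var_y1 * var_y2"
  let ?Cl = "fps1_subst c (scalar3 \<theta> * ?v)"
  let ?L = "?Cl * ?M - (fps1_subst c1 ?v * mono3 (of_nat p * s) 0 p q
              + fps1_subst c2 ?v * mono3 (of_nat q * s) 0 p q)"
  have c0: "c $ 0 = 0" by (simp add: c c1 c2)
  have F1: "vanish_below 0 1 F"
    using vanish_below_add[of 0 1 "F - ?M" ?M] vanish_below_mono[OF F D]
      vanish_below_mono3[of 1 0 0 p q s] pq by simp
  define E where "E = fps1_subst c1 ?v * (deriv_y1 (F - ?M) * var_y1)
       + fps1_subst c2 ?v * (deriv_y2 (F - ?M) * var_y2)"
  have "vanish_below 0 (2 + D) E"
    unfolding E_def
    by (intro vanish_below_add vanish_below_mult F vanish_below_euler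
        vanish_below_fps1_subst_scaled c1 c2)
  then have E: "vanish_below 0 (D + 1) E"
    by (rule vanish_below_mono) simp
  have "vanish_below 0 (2 + D) (?Cl * (F - ?M))"
    by (intro vanish_below_mult F vanish_below_fps1_subst_scaled c0)
  then have "vanish_below 0 (D + 1) (?Cl * (F - ?M))"
    by (rule vanish_below_mono) simp
  moreover have "vanish_below 0 (D + 1) ((C - ?Cl) * F)"
    by (intro vanish_below_mult C F1)
  moreover have "R - ?L = (C - ?Cl) * F + ?Cl * (F - ?M) - E"
    unfolding R_def E_def euler_diff euler_mono3 by (simp add: algebra_simps)
  ultimately have "vanish_below 0 (D + 1) (R - ?L)"
    using E by (simp only: vanish_below_add vanish_below_diff)
  then have "(R - ?L) $ i $ j $ k = 0"
    by (rule vanish_belowD) (use jk in simp)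
  then have "R $ i $ j $ k = ?L $ i $ j $ k" by simp
  also have "\<dots> = (if i = 0 \<and> p \<le> j \<and> q \<le> k \<and> j - p = k - q
      then s * (c $ (j - p) * (\<theta> ^ (j - p) - 1)) else 0)"
    unfolding fps_sub_nth fps_add_nth mult_mono3_nth fps1_subst_scaled_nth fps1_subst_y1_y2_nth c
    by (simp add: algebra_simps)
  finally show ?thesis .
qed

text \<open>In degree \<open>D\<close> the term \<open>R\<close> lives only at \<open>x^0\<close>
  and on resonant monomials, so the equations at positive powers of \<open>x\<close> are homogeneous
  and already force every resonant coefficient to vanish.\<close>

lemma vanish_below_step:
  assumes D: "D \<ge> 2" and F: "vanish_below 0 D (F - mono3 s 0 p q)"
    and C: "vanish_below 0 D (C - fps1_subst c (scalar3 \<theta> * (var_y1 * var_y2)))"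
  shows "vanish_below 0 (Suc D) (F - mono3 s 0 p q)"
proof -
  note R = R_leading[OF order_trans[OF _ D] F C, simplified]
  have "F $ i $ j $ k = 0" if jk: "j + k = D" for i j k
  proof (cases "k + p = j + q")
    case False
    then show ?thesis
      using R[OF jk] by (intro nonresonant_coeff) auto
  next
    case True
    define n where "n = j - p"
    \<comment> \<open>\<open>D = 2 * n + 1\<close>, so \<open>D \<ge> 2\<close> excludes
      \<open>n = 0\<close>, where the nonresonance condition fails at \<open>i = 0\<close>.\<close>
    have n: "j = n + p" "k = n + q" "n > 0"
      using True pq D jk unfolding n_def by (cases p; simp)+
    have "(of_nat i + of_nat n * (a1 + a2)) * F $ i $ j $ k = 0"
      using coeff_equation[of k j "Suc i"] R[OF jk, of "Suc i"]
      by (simp add: n algebra_simps)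
    then show ?thesis using nonres[of n i] n(3) by simp
  qed
  moreover have "mono3 s 0 p q $ i $ j $ k = 0" if "j + k = D" for i j k
    using that D pq by (auto simp: mono3_nth)
  ultimately show ?thesis
    using F by (auto simp: vanish_below_def less_Suc_eq)
qed

text \<open>This is the equation at \<open>x^0\<close> for a resonant monomial: its left side
  vanishes, so \<open>s * c $ n * (\<theta> ^ n - 1) = 0\<close>.\<close>

lemma invariance_coeff:
  assumes F: "F = mono3 s 0 p q" and s: "s \<noteq> 0"
    and C: "C = fps1_subst c (scalar3 \<theta> * (var_y1 * var_y2))"
  shows "c $ n * \<theta> ^ n = c $ n"
proof -
  have "R $ 0 $ (n + p) $ (n + q) = s * (c $ n * (\<theta> ^ n - 1))"
    using R_leading[of "n + p + (n + q)" s \<theta> "n + p" "n + q" 0] pq by (simp add: F C)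
  then show ?thesis
    using coeff_equation[of "n + q" "n + p" 0] s by (simp add: algebra_simps)
qed

end

subsection \<open>The isotropy group\<close>

lemma triple_comp_Z_field:
  assumes "vanishes_at_origin (var_x, G1, G2)"
  shows "triple_comp (Z_field lam a1 a2 c1 c2) (var_x, G1, G2) =
    (var_x ^ 2,
     (- scalar3 lam + scalar3 a1 * var_x + fps1_subst c1 (G1 * G2)) * G1,
     (scalar3 lam + scalar3 a2 * var_x + fps1_subst c2 (G1 * G2)) * G2)"
proof -
  have "vanish_below 1 1 (var_y1 * var_y2)"
    using vanishes_at_origin_id_map
    by (auto simp: id_map_def vanishes_at_origin_iff intro: vanish_below_mult_left)
  then show ?thesis
    by (simp add: triple_comp_def Z_field_def fps3_subst_mult[OF assms] fps3_subst_add
        fps3_subst_diff fps3_subst_uminus fps3_subst_scalar3[OF assms] fps3_subst_var[OF assms]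
        fps3_subst_power[OF assms] fps3_subst_fps1_subst[OF assms])
qed

section \<open>Diagonal maps as isotropies\<close>

lemma directional_deriv_linear:
  "directional_deriv var_x (X1, X2, X3) = X1"
  "directional_deriv (scalar3 s * var_y1) (X1, X2, X3) = scalar3 s * X2"
  "directional_deriv (scalar3 s * var_y2) (X1, X2, X3) = scalar3 s * X3"
proof -
  have "deriv_x var_x = 1" "deriv_y1 var_x = 0" "deriv_y2 var_x = 0"
    "deriv_x (scalar3 s * var_y1) = 0" "deriv_y1 (scalar3 s * var_y1) = scalar3 s"
    "deriv_y2 (scalar3 s * var_y1) = 0" "deriv_x (scalar3 s * var_y2) = 0"
    "deriv_y1 (scalar3 s * var_y2) = 0" "deriv_y2 (scalar3 s * var_y2) = scalar3 s"
    by (auto intro!: fps3_eqI simp: deriv_x_def deriv_y1_def deriv_y2_def var_x_def var_y1_def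
        var_y2_def scalar3_def fps_X_def simp flip: fps_of_nat)
  then show "directional_deriv var_x (X1, X2, X3) = X1"
    "directional_deriv (scalar3 s * var_y1) (X1, X2, X3) = scalar3 s * X2"
    "directional_deriv (scalar3 s * var_y2) (X1, X2, X3) = scalar3 s * X3"
    by (simp_all add: directional_deriv_def)
qed

lemma vanishes_at_origin_diag_map: "vanishes_at_origin (diag_map 1 \<theta>1 \<theta>2)"
  by (simp add: vanishes_at_origin_def diag_map_def) (simp add: var_x_def var_y1_def var_y2_def)

lemma triple_comp_diag_map:
  "triple_comp (diag_map 1 s t) (diag_map 1 s' t') = diag_map 1 (s * s') (t * t')"
proof -
  note G = vanishes_at_origin_diag_map[of s' t', unfolded diag_map_def]
  show ?thesis
    by (simp add: triple_comp_def diag_map_def fps3_subst_mult[OF G] fps3_subst_scalar3[OF G]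
        fps3_subst_var[OF G]) (simp add: scalar3_hom mult_ac)
qed

lemma diag_map_in_formal_diffeo_fib:
  assumes "\<theta>1 \<noteq> 0" "\<theta>2 \<noteq> 0"
  shows "diag_map 1 \<theta>1 \<theta>2 \<in> formal_diffeo_fib"
proof -
  have "diag_map 1 1 1 = id_map" by (simp add: diag_map_def id_map_def scalar3_hom)
  then have "is_formal_inverse (diag_map 1 \<theta>1 \<theta>2) (diag_map 1 (1 / \<theta>1) (1 / \<theta>2))"
    using assms
    by (simp add: is_formal_inverse_def vanishes_at_origin_diag_map triple_comp_diag_map)
  moreover have "fst (diag_map 1 \<theta>1 \<theta>2) = var_x"
    by (simp add: diag_map_def scalar3_hom)
  ultimately show ?thesis
    unfolding formal_diffeo_fib_def formal_diffeo_def using vanishes_at_origin_diag_map by blast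
qed

lemma fps_compose_scaled_eq_iff:
  "c oo (fps_const \<theta> * fps_X) = c \<longleftrightarrow> (\<forall>n. c $ n * \<theta> ^ n = c $ n)" for c :: "complex fps"
  unfolding fps_compose_linear fps_eq_iff by (simp add: mult.commute)

lemma fps1_subst_scaled:
  assumes "\<forall>n. c $ n * \<theta> ^ n = c $ n"
  shows "fps1_subst c (scalar3 \<theta> * (var_y1 * var_y2)) = fps1_subst c (var_y1 * var_y2)"
  by (rule fps3_eqI) (use assms in \<open>simp add: fps1_subst_scaled_nth fps1_subst_y1_y2_nth\<close>)

lemma isot_fib_iff:
  "\<Phi> \<in> isot_fib X \<longleftrightarrow>
     \<Phi> \<in> formal_diffeo_fib \<and> jacobian_apply \<Phi> X = triple_comp X \<Phi>"
  by (auto simp: isot_fib_def formal_diffeo_fib_def pushforward_eq_iff)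

lemma diag_map_in_isot_fib:
  assumes \<theta>: "\<theta>1 \<noteq> 0" "\<theta>2 \<noteq> 0"
    and c: "\<forall>n. c1 $ n * (\<theta>1 * \<theta>2) ^ n = c1 $ n" "\<forall>n. c2 $ n * (\<theta>1 * \<theta>2) ^ n = c2 $ n"
  shows "diag_map 1 \<theta>1 \<theta>2 \<in> isot_fib (Z_field lam a1 a2 c1 c2)"
proof -
  let ?G1 = "scalar3 \<theta>1 * var_y1" and ?G2 = "scalar3 \<theta>2 * var_y2"
  have diag: "diag_map 1 \<theta>1 \<theta>2 = (var_x, ?G1, ?G2)"
    by (simp add: diag_map_def scalar3_hom)
  have prod: "?G1 * ?G2 = scalar3 (\<theta>1 * \<theta>2) * (var_y1 * var_y2)"
    by (simp add: scalar3_hom mult_ac)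
  note G = vanishes_at_origin_diag_map[of \<theta>1 \<theta>2, unfolded diag]
  have "jacobian_apply (var_x, ?G1, ?G2) (Z_field lam a1 a2 c1 c2) =
      triple_comp (Z_field lam a1 a2 c1 c2) (var_x, ?G1, ?G2)"
    unfolding triple_comp_Z_field[OF G] prod fps1_subst_scaled[OF c(1)] fps1_subst_scaled[OF c(2)]
    by (simp add: jacobian_apply_def Z_field_def directional_deriv_linear mult.left_commute mult.assoc)
  then show ?thesis
    using diag_map_in_formal_diffeo_fib[OF \<theta>] by (simp add: isot_fib_iff diag)
qed

section \<open>Every isotropy is diagonal\<close>

lemma nonresonance:
  fixes a :: complex
  assumes "a \<notin> of_rat ` {q :: rat. q \<le> 0}" "n > 0"
  shows "of_nat i + of_nat n * a \<noteq> 0"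
proof
  assume "of_nat i + of_nat n * a = 0"
  then have "a = of_rat (- (of_nat i / of_nat n))"
    using assms(2) by (simp add: of_rat_minus of_rat_divide field_simps add_eq_0_iff2)
  then show False using assms(1) by auto
qed

lemma isot_fib_imp_diag_map:
  assumes lam: "lam \<noteq> 0" and a: "a1 + a2 \<notin> of_rat ` {q :: rat. q \<le> 0}"
    and c0: "c1 $ 0 = 0" "c2 $ 0 = 0"
    and \<Phi>: "\<Phi> \<in> isot_fib (Z_field lam a1 a2 c1 c2)"
  obtains \<theta>1 \<theta>2 where "\<Phi> = diag_map 1 \<theta>1 \<theta>2" "\<theta>1 \<noteq> 0" "\<theta>2 \<noteq> 0"
    "\<forall>n. c1 $ n * (\<theta>1 * \<theta>2) ^ n = c1 $ n" "\<forall>n. c2 $ n * (\<theta>1 * \<theta>2) ^ n = c2 $ n"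
proof -
  let ?Z = "Z_field lam a1 a2 c1 c2" and ?v = "var_y1 * var_y2"
  obtain F1 F2 where \<Phi>_eq: "\<Phi> = (var_x, F1, F2)"
    using \<Phi> by (cases \<Phi>) (auto simp: isot_fib_def formal_diffeo_fib_def)
  have diffeo: "\<Phi> \<in> formal_diffeo"
    using \<Phi> by (simp add: isot_fib_def formal_diffeo_fib_def)
  then have van: "vanishes_at_origin (var_x, F1, F2)"
    by (simp add: formal_diffeo_def \<Phi>_eq)
  let ?C = "\<lambda>c. fps1_subst c (F1 * F2)"
  have eqs: "directional_deriv F1 ?Z = (- scalar3 lam + scalar3 a1 * var_x + ?C c1) * F1"
    "directional_deriv F2 ?Z = (scalar3 lam + scalar3 a2 * var_x + ?C c2) * F2"
    using \<Phi> unfolding isot_fib_iff \<Phi>_eq triple_comp_Z_field[OF van]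
    by (simp_all add: jacobian_apply_def)
  \<comment> \<open>Treating \<open>c1(F1 * F2)\<close> and \<open>c2(F1 * F2)\<close> as given
    series makes each equation linear in its own unknown.\<close>
  interpret e1: Z_eigen lam a1 a2 c1 c2 c1 1 0 F1 "?C c1"
    by unfold_locales (use lam c0 eqs nonresonance[OF a] in \<open>simp_all add: scalar3_hom\<close>)
  interpret e2: Z_eigen lam a1 a2 c1 c2 c2 0 1 F2 "?C c2"
    by unfold_locales (use lam c0 eqs nonresonance[OF a] in \<open>simp_all add: scalar3_hom\<close>)
  have C: "?C c $ 0 $ 0 $ 0 = 0" if "c $ 0 = 0" for c
    using that by (simp add: fps1_subst_nth)
  note F = e1.vanish_below_1[OF C[OF c0(1)]] e2.vanish_below_1[OF C[OF c0(2)]]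
  have "vanish_below 0 2 (F1 * F2)"
    using vanish_below_mult[OF F] by (simp add: numeral_2_eq_2)
  then have C2: "vanish_below 0 2 (?C c1)" "vanish_below 0 2 (?C c2)"
    by (auto intro: vanish_below_fps1_subst c0)
  define \<theta>1 where "\<theta>1 = F1 $ 0 $ 1 $ 0"
  define \<theta>2 where "\<theta>2 = F2 $ 0 $ 0 $ 1"
  let ?M1 = "mono3 \<theta>1 0 1 0" and ?M2 = "mono3 \<theta>2 0 0 1" and ?w = "scalar3 (\<theta>1 * \<theta>2) * ?v"
  have M12: "?M1 * ?M2 = ?w" by (simp add: mono3_def scalar3_hom mult_ac)
  \<comment> \<open>Both components advance together, since the error in \<open>F1 * F2\<close>
    depends on both. The shift by 2 starts the induction after the linear part is known.\<close>
  have "vanish_below 0 (D + 2) (F1 - ?M1) \<and> vanish_below 0 (D + 2) (F2 - ?M2)" for D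
  proof (induction D)
    case 0
    show ?case
      using e1.vanish_below_2[OF F(1) C2(1)] e2.vanish_below_2[OF F(2) C2(2)]
      by (simp add: \<theta>1_def \<theta>2_def numeral_2_eq_2)
  next
    case (Suc D)
    have "F1 * F2 - ?w = (F1 - ?M1) * F2 + ?M1 * (F2 - ?M2)"
      unfolding M12[symmetric] by (simp add: left_diff_distrib right_diff_distrib)
    then have "vanish_below 0 (D + 2) (F1 * F2 - ?w)"
      using Suc by (simp only: vanish_below_add vanish_below_mult_left vanish_below_mult_right)
    then have "vanish_below 0 (D + 2) (?C c - fps1_subst c ?w)" for c
      by (rule vanish_below_fps1_subst_diff)
    then show ?case
      using e1.vanish_below_step[of "D + 2" \<theta>1 "\<theta>1 * \<theta>2"]
        e2.vanish_below_step[of "D + 2" \<theta>2 "\<theta>1 * \<theta>2"] Suc by simp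
  qed
  then have "vanish_below 0 D (F1 - ?M1)" "vanish_below 0 D (F2 - ?M2)" for D
    by (meson vanish_below_mono le_add1)+
  then have F_eq: "F1 = ?M1" "F2 = ?M2"
    by (blast intro: fps3_eqI_vanish_below)+
  have \<Phi>_diag: "\<Phi> = diag_map 1 \<theta>1 \<theta>2"
    by (simp add: \<Phi>_eq F_eq diag_map_def mono3_def scalar3_hom)
  obtain \<Psi> where \<Psi>: "vanishes_at_origin \<Psi>" "triple_comp \<Phi> \<Psi> = id_map"
    using diffeo unfolding formal_diffeo_def is_formal_inverse_def by blast
  obtain G0 G1 G2 where \<Psi>_eq: "\<Psi> = (G0, G1, G2)" by (cases \<Psi>)
  \<comment> \<open>Invertibility enters here: a zero multiplier would make a coordinate of
    \<open>\<Phi> \<circ> \<Psi>\<close> vanish.\<close>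
  have "scalar3 \<theta>1 * G1 = var_y1" "scalar3 \<theta>2 * G2 = var_y2"
    using \<Psi> unfolding \<Phi>_eq F_eq \<Psi>_eq by (simp_all add: triple_comp_def id_map_def fps3_subst_mono3)
  then have "\<theta>1 \<noteq> 0" "\<theta>2 \<noteq> 0"
    by (auto simp: scalar3_hom var_y1_def var_y2_def)
  moreover have "?C c = fps1_subst c ?w" for c
    by (simp only: F_eq M12)
  ultimately show thesis
    using that \<Phi>_diag e1.invariance_coeff[OF F_eq(1)] e2.invariance_coeff[OF F_eq(2)] by blast
qed

theorem proposition3p2:
  fixes lam a1 a2 :: complex and c1 c2 :: "complex fps"
  assumes "lam \<noteq> 0"
    and "a1 + a2 \<notin> of_rat ` {q :: rat. q \<le> 0}"
    and "c1 $ 0 = 0" and "c2 $ 0 = 0"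
  shows "isot_fib (Z_field lam a1 a2 c1 c2) =
    {diag_map 1 \<theta>1 \<theta>2 | \<theta>1 \<theta>2. \<theta>1 \<noteq> 0 \<and> \<theta>2 \<noteq> 0 \<and>
       (c1 oo (fps_const (\<theta>1 * \<theta>2) * fps_X), c2 oo (fps_const (\<theta>1 * \<theta>2) * fps_X)) = (c1, c2)}"
  unfolding prod.inject fps_compose_scaled_eq_iff
  using diag_map_in_isot_fib isot_fib_imp_diag_map[OF assms] by blast

end
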